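(* Let $G$ be a finite group and let $N$ be a normal subgroup of $G$. Then $n(\Gamma_G(N)) \leq 2$, that is, the graph $\Gamma_G(N)$ has at most two connected components.
   Context: For a finite group $G$ and a normal subgroup $N$ of $G$, $\mathrm{Con}_G(N)$ denotes the set of $G$-conjugacy classes $x^G=\{x^g \mid g\in G\}$ of elements $x\in N$. A class $x^G$ is central if $x\in \mathbf{Z}(G)$ (equivalently $|x^G|=1$), and non-central otherwise. The graph $\Gamma_G(N)$ is the simple graph whose vertices are the non-central elements of $\mathrm{Con}_G(N)$, two distinct vertices $x^G$ and $y^G$ being joined by an edge if and only if $|x^G|$ and $|y^G|$ have a common prime divisor. The number of connected components of a graph $\Gamma$ is denoted by $n(\Gamma)$. *)

theory Defs
  imports
    "HOL-Algebra.Coset"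
    "HOL-Computational_Algebra.Primes"
    "Graph_Theory.Digraph_Component"
begin

definition group_center :: "('a, 'b) monoid_scheme \<Rightarrow> 'a set" where
  "group_center G = {z \<in> carrier G. \<forall>g \<in> carrier G. z \<otimes>\<^bsub>G\<^esub> g = g \<otimes>\<^bsub>G\<^esub> z}"

definition conj_class :: "('a, 'b) monoid_scheme \<Rightarrow> 'a \<Rightarrow> 'a set" where
  "conj_class G x = {inv\<^bsub>G\<^esub> g \<otimes>\<^bsub>G\<^esub> x \<otimes>\<^bsub>G\<^esub> g | g. g \<in> carrier G}"

definition conj_classes :: "('a, 'b) monoid_scheme \<Rightarrow> 'a set \<Rightarrow> 'a set set" where
  "conj_classes G N = {conj_class G x | x. x \<in> N}"

definition central_class :: "('a, 'b) monoid_scheme \<Rightarrow> 'a set \<Rightarrow> bool" where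
  "central_class G C \<longleftrightarrow> (\<exists>x \<in> group_center G. C = conj_class G x)"

text \<open>A simple graph is encoded as a loop-free symmetric digraph; an undirected edge is a pair
  of opposite arcs.\<close>

definition class_graph :: "('a, 'b) monoid_scheme \<Rightarrow> 'a set \<Rightarrow> 'a set pair_pre_digraph" where
  "class_graph G N =
    (let V = {C \<in> conj_classes G N. \<not> central_class G C}
     in \<lparr> pverts = V,
          parcs = {(C, D). C \<in> V \<and> D \<in> V \<and> C \<noteq> D \<and>
                     (\<exists>p::nat. prime p \<and> p dvd card C \<and> p dvd card D)} \<rparr>)"

text \<open>In a symmetric digraph the strongly connected components are the connected components of
  the underlying undirected graph. The two lemmas after the definition ensure that this applies
  to the graph above, and that the \<^const>\<open>card\<close> below is that of a finite set.\<close>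

definition n_components :: "'v pair_pre_digraph \<Rightarrow> nat" where
  "n_components \<Gamma> = card (pre_digraph.sccs (with_proj \<Gamma>))"

lemma pair_graph_class_graph:
  assumes "finite N"
  shows "pair_graph (class_graph G N)"
proof -
  let ?V = "{C \<in> conj_classes G N. \<not> central_class G C}"
  have V: "finite ?V"
    using assms by (auto simp: conj_classes_def)
  have "parcs (class_graph G N) \<subseteq> ?V \<times> ?V"
    by (auto simp: class_graph_def)
  then have "finite (parcs (class_graph G N))"
    using V finite_subset by blast
  then show ?thesis
    using V by unfold_locales (auto simp: class_graph_def symmetric_def sym_def)
qed

lemma finite_sccs_class_graph:
  assumes "finite N"
  shows "finite (pre_digraph.sccs (with_proj (class_graph G N)))"
proof -
  interpret pair_graph "class_graph G N"
    using assms by (rule pair_graph_class_graph)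
  show ?thesis
    using finite_sccs_verts by (simp add: sccs_conv_sccs_verts)
qed

end

theory Submission
  imports Defs
begin

text \<open>Suppose three classes \<open>B\<close>, \<open>C\<close>, \<open>D\<close> lie in distinct components. Their
  sizes are pairwise coprime and greater than 1, so we may take \<open>|B| < |C| < |D|\<close>. Coprimality
  makes \<open>BC\<close> a single class of size dividing \<open>|B||C|\<close>. As \<open>B\<close> and \<open>C\<close> have no common
  neighbour and \<open>|BC| \<ge> |C|\<close>, this size is \<open>|C|\<close>. Hence \<open>bC = BC\<close> for every
  \<open>b\<close> in \<open>B\<close>, so all quotients of elements of \<open>B\<close> stabilise \<open>C\<close> under left
  multiplication, and likewise \<open>D\<close>. The stabilisers act freely, so their orders divide the coprime
  numbers \<open>|C|\<close> and \<open>|D|\<close>, and they intersect trivially. Thus \<open>|B| = 1\<close>, a contradiction.\<close>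

section \<open>Counting fibres and common prime divisors\<close>

text \<open>The maps \<open>s\<close> carry fibres of \<open>f\<close> injectively into fibres, so
  all fibres on \<open>P\<close> have the same size and \<open>card P\<close> is that size times the
  number of values. The hypothesis distils what is needed from a transitive group action for which
  \<open>f\<close> is equivariant.\<close>

lemma card_image_dvd_of_transitive:
  assumes fin: "finite P"
    and trans: "\<And>p q. p \<in> P \<Longrightarrow> q \<in> P \<Longrightarrow>
      \<exists>s. inj_on s P \<and> s ` P \<subseteq> P \<and> s p = q \<and> (\<forall>u\<in>P. \<forall>v\<in>P. f u = f v \<longrightarrow> f (s u) = f (s v))"
  shows "card (f ` P) dvd card P"
proof (cases "P = {}")
  case False
  then obtain p0 where p0: "p0 \<in> P" by blast
  define F where "F p = {u \<in> P. f u = f p}" for p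
  \<comment> \<open>One inequality suffices, as \<open>p\<close> and \<open>q\<close> may be
    swapped.\<close>
  have le: "card (F p) \<le> card (F q)" if p: "p \<in> P" and q: "q \<in> P" for p q
  proof -
    obtain s where s: "inj_on s P" "s ` P \<subseteq> P" "s p = q"
        "\<forall>u\<in>P. \<forall>v\<in>P. f u = f v \<longrightarrow> f (s u) = f (s v)"
      using trans[OF p q] by blast
    have "s ` F p \<subseteq> F q"
      using s p unfolding F_def by blast
    moreover have "inj_on s (F p)"
      using s(1) by (rule inj_on_subset) (auto simp: F_def)
    ultimately show ?thesis
      using fin by (intro card_inj_on_le) (auto simp: F_def)
  qed
  have "card P = (\<Sum>y\<in>f ` P. card {u \<in> P. f u = y})"
    unfolding card_eq_sum by (rule sum.image_gen[OF fin])
  also have "\<dots> = (\<Sum>y\<in>f ` P. card (F p0))"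
  proof (rule sum.cong)
    fix y assume "y \<in> f ` P"
    then obtain p where "p \<in> P" "y = f p" by blast
    then show "card {u \<in> P. f u = y} = card (F p0)"
      using le[OF p0, of p] le[OF _ p0, of p] by (simp add: F_def)
  qed simp
  finally show ?thesis by simp
qed simp

lemma ex_prime_dvd_both:
  fixes m n :: nat
  assumes "\<not> coprime m n"
  shows "\<exists>p. prime p \<and> p dvd m \<and> p dvd n"
proof -
  have "gcd m n \<noteq> 1"
    using assms by (simp add: coprime_iff_gcd_eq_1)
  then show ?thesis
    using prime_factor_nat by (meson dvd_trans gcd_dvd1 gcd_dvd2)
qed

section \<open>Conjugation and class sizes\<close>

context group
begin

definition conj_by :: "'a \<Rightarrow> 'a \<Rightarrow> 'a" where
  "conj_by g x = inv g \<otimes> x \<otimes> g"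

lemma conj_class_eq: "conj_class G x = (\<lambda>g. conj_by g x) ` carrier G"
  by (auto simp: conj_class_def conj_by_def)

lemma conj_by_closed [simp]:
  "g \<in> carrier G \<Longrightarrow> x \<in> carrier G \<Longrightarrow> conj_by g x \<in> carrier G"
  by (simp add: conj_by_def)

lemma conj_by_conj_by:
  "g \<in> carrier G \<Longrightarrow> h \<in> carrier G \<Longrightarrow> x \<in> carrier G \<Longrightarrow>
    conj_by h (conj_by g x) = conj_by (g \<otimes> h) x"
  by (simp add: conj_by_def inv_mult_group m_assoc)

lemma conj_by_one [simp]: "x \<in> carrier G \<Longrightarrow> conj_by \<one> x = x"
  by (simp add: conj_by_def)

lemma conj_by_mult:
  assumes "g \<in> carrier G" "x \<in> carrier G" "y \<in> carrier G"
  shows "conj_by g (x \<otimes> y) = conj_by g x \<otimes> conj_by g y"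
proof -
  have "g \<otimes> (inv g \<otimes> (y \<otimes> g)) = y \<otimes> g"
    using assms by (simp flip: m_assoc)
  then show ?thesis
    using assms by (simp add: conj_by_def m_assoc)
qed

lemma conj_by_inj:
  assumes "g \<in> carrier G" "x \<in> carrier G" "y \<in> carrier G" "conj_by g x = conj_by g y"
  shows "x = y"
  using assms by (simp add: conj_by_def)

lemma conj_class_subset: "x \<in> carrier G \<Longrightarrow> conj_class G x \<subseteq> carrier G"
  by (auto simp: conj_class_eq)

lemma conj_class_self: "x \<in> carrier G \<Longrightarrow> x \<in> conj_class G x"
  unfolding conj_class_eq by (rule image_eqI[of _ _ \<one>]) auto

text \<open>An element is central exactly when every conjugation fixes it. Being a vertex thus
  becomes a condition on the class size, the only datum that coprimality sees.\<close>

lemma central_class_iff_card: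
  assumes x: "x \<in> carrier G"
  shows "central_class G (conj_class G x) \<longleftrightarrow> card (conj_class G x) = 1"
proof
  assume "central_class G (conj_class G x)"
  then obtain z where z: "z \<in> group_center G" "conj_class G x = conj_class G z"
    by (auto simp: central_class_def)
  have "conj_by g z = z" if g: "g \<in> carrier G" for g
  proof -
    have "z \<otimes> g = g \<otimes> z" "z \<in> carrier G"
      using z(1) g by (auto simp: group_center_def)
    then show ?thesis
      using g by (metis conj_by_def inv_closed l_inv l_one m_assoc)
  qed
  then have "conj_class G z = {z}"
    unfolding conj_class_eq by (auto simp: image_iff)
  then show "card (conj_class G x) = 1"
    using z(2) by simp
next
  assume "card (conj_class G x) = 1"
  then have *: "conj_class G x = {x}"
    using conj_class_self[OF x] by (auto simp: card_1_singleton_iff)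
  have "x \<otimes> g = g \<otimes> x" if g: "g \<in> carrier G" for g
  proof -
    have "inv g \<otimes> (x \<otimes> g) = x"
      using * g x by (auto simp: conj_class_eq conj_by_def m_assoc)
    then show ?thesis
      using g x by (metis inv_solve_left m_closed)
  qed
  then show "central_class G (conj_class G x)"
    using x by (auto simp: central_class_def group_center_def)
qed

section \<open>Simultaneous conjugation of pairs\<close>

definition conj_orbit2 :: "'a \<Rightarrow> 'a \<Rightarrow> ('a \<times> 'a) set" where
  "conj_orbit2 b c = (\<lambda>g. (conj_by g b, conj_by g c)) ` carrier G"

text \<open>Conjugation is transitive on the orbit, and equivariance makes it respect the fibres of
  \<open>f\<close>. The instances of interest are \<open>fst\<close>, \<open>snd\<close> and
  multiplication.\<close>

lemma card_image_conj_orbit2_dvd: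
  assumes fin: "finite (carrier G)" and b: "b \<in> carrier G" and c: "c \<in> carrier G"
    and equiv: "\<And>g x y. g \<in> carrier G \<Longrightarrow> x \<in> carrier G \<Longrightarrow> y \<in> carrier G \<Longrightarrow>
      f (conj_by g x, conj_by g y) = conj_by g (f (x, y))"
  shows "card (f ` conj_orbit2 b c) dvd card (conj_orbit2 b c)"
proof (rule card_image_dvd_of_transitive)
  show "finite (conj_orbit2 b c)"
    using fin by (simp add: conj_orbit2_def)
next
  fix p q assume "p \<in> conj_orbit2 b c" "q \<in> conj_orbit2 b c"
  then obtain g h where g: "g \<in> carrier G" "p = (conj_by g b, conj_by g c)"
    and h: "h \<in> carrier G" "q = (conj_by h b, conj_by h c)"
    by (auto simp: conj_orbit2_def)
  \<comment> \<open>Conjugating by \<open>inv g\<close> returns \<open>p\<close> to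
    \<open>(b, c)\<close>, and conjugating by \<open>h\<close> then leads to
    \<open>q\<close>.\<close>
  define k where "k = inv g \<otimes> h"
  have k: "k \<in> carrier G" using g h by (simp add: k_def)
  have gk: "g \<otimes> k = h" using g h by (simp add: k_def flip: m_assoc)
  let ?s = "\<lambda>(x, y). (conj_by k x, conj_by k y)"
  have sub: "conj_orbit2 b c \<subseteq> carrier G \<times> carrier G"
    using b c by (auto simp: conj_orbit2_def)
  have "inj_on ?s (conj_orbit2 b c)"
  proof (rule inj_onI)
    fix u v assume "u \<in> conj_orbit2 b c" "v \<in> conj_orbit2 b c" "?s u = ?s v"
    then show "u = v"
      using sub by (cases u; cases v) (auto intro: conj_by_inj[OF k])
  qed
  moreover have "?s ` conj_orbit2 b c \<subseteq> conj_orbit2 b c"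
    using k b c by (auto simp: conj_orbit2_def conj_by_conj_by)
  moreover have "?s p = q"
    using g h k b c by (simp add: conj_by_conj_by gk)
  moreover have "\<forall>u\<in>conj_orbit2 b c. \<forall>v\<in>conj_orbit2 b c. f u = f v \<longrightarrow> f (?s u) = f (?s v)"
  proof -
    have "f (?s u) = conj_by k (f u)" if "u \<in> conj_orbit2 b c" for u
      using that sub k by (cases u) (auto intro: equiv)
    then show ?thesis by simp
  qed
  ultimately show "\<exists>s. inj_on s (conj_orbit2 b c) \<and> s ` conj_orbit2 b c \<subseteq> conj_orbit2 b c \<and>
      s p = q \<and> (\<forall>u\<in>conj_orbit2 b c. \<forall>v\<in>conj_orbit2 b c. f u = f v \<longrightarrow> f (s u) = f (s v))"
    by blast
qed

text \<open>The orbit projects equivariantly onto both classes, so its size is a multiple of each of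
  the two coprime class sizes.\<close>

lemma conj_orbit2_eq_Times:
  assumes fin: "finite (carrier G)" and b: "b \<in> carrier G" and c: "c \<in> carrier G"
    and cop: "coprime (card (conj_class G b)) (card (conj_class G c))"
  shows "conj_orbit2 b c = conj_class G b \<times> conj_class G c"
proof (rule card_seteq)
  have fst: "fst ` conj_orbit2 b c = conj_class G b"
    and snd: "snd ` conj_orbit2 b c = conj_class G c"
    by (auto simp: conj_orbit2_def conj_class_eq image_image)
  have "card (conj_class G b) dvd card (conj_orbit2 b c)"
    using card_image_conj_orbit2_dvd[OF fin b c, of fst] fst by simp
  moreover have "card (conj_class G c) dvd card (conj_orbit2 b c)"
    using card_image_conj_orbit2_dvd[OF fin b c, of snd] snd by simp
  ultimately have "card (conj_class G b) * card (conj_class G c) dvd card (conj_orbit2 b c)"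
    using cop by (rule divides_mult)
  moreover have "card (conj_orbit2 b c) > 0"
    using fin by (auto simp: card_gt_0_iff conj_orbit2_def)
  ultimately show "card (conj_class G b \<times> conj_class G c) \<le> card (conj_orbit2 b c)"
    by (simp add: card_cartesian_product dvd_imp_le)
  show "finite (conj_class G b \<times> conj_class G c)"
    using fin by (simp add: conj_class_eq)
  show "conj_orbit2 b c \<subseteq> conj_class G b \<times> conj_class G c"
    by (auto simp: conj_orbit2_def conj_class_eq)
qed

text \<open>The translate lies in the class of \<open>b \<otimes> c\<close> and has as many elements
  as the class of \<open>c\<close>, so it fills the product class once that class is shown to be no
  larger. Assumption \<open>E\<close> expresses that the product class does not share primes with
  both factors.\<close>

lemma coprime_class_translate:
  assumes fin: "finite (carrier G)" and b: "b \<in> carrier G" and c: "c \<in> carrier G"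
    and cop: "coprime (card (conj_class G b)) (card (conj_class G c))"
    and less: "card (conj_class G b) < card (conj_class G c)"
    and E: "coprime (card (conj_class G (b \<otimes> c))) (card (conj_class G b)) \<or>
      coprime (card (conj_class G (b \<otimes> c))) (card (conj_class G c))"
    and b': "b' \<in> conj_class G b"
  shows "b' <# conj_class G c = conj_class G (b \<otimes> c)"
proof -
  let ?B = "conj_class G b" and ?C = "conj_class G c" and ?E = "conj_class G (b \<otimes> c)"
  have times: "conj_orbit2 b c = ?B \<times> ?C"
    by (rule conj_orbit2_eq_Times[OF fin b c cop])
  have finE: "finite ?E" and finB: "finite ?B"
    using fin by (simp_all add: conj_class_eq)
  have Bpos: "card ?B > 0"
    using b' finB by (auto simp: card_gt_0_iff)
  \<comment> \<open>Multiplication is equivariant, so it maps the orbit of \<open>(b, c)\<close>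
    onto the class of \<open>b \<otimes> c\<close>.\<close>
  have "(\<lambda>(x, y). x \<otimes> y) ` conj_orbit2 b c = ?E"
    using b c by (auto simp: conj_orbit2_def conj_class_eq image_image conj_by_mult)
  then have dvd: "card ?E dvd card ?B * card ?C"
    using card_image_conj_orbit2_dvd[OF fin b c, of "\<lambda>(x, y). x \<otimes> y"] b c
    by (simp add: conj_by_mult times card_cartesian_product)
  have b'G: "b' \<in> carrier G"
    using b' conj_class_subset[OF b] by blast
  have sub: "b' <# ?C \<subseteq> ?E"
  proof
    fix e assume "e \<in> b' <# ?C"
    then obtain c' where c': "c' \<in> ?C" "e = b' \<otimes> c'"
      by (auto simp: l_coset_def)
    \<comment> \<open>The orbit is the full product of the classes, so this pair is a simultaneous
      conjugate of \<open>(b, c)\<close>.\<close>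
    then have "(b', c') \<in> conj_orbit2 b c"
      using b' by (simp add: times)
    then show "e \<in> ?E"
      using b c c'(2) by (auto simp: conj_orbit2_def conj_class_eq conj_by_mult[symmetric])
  qed
  have "b' <# ?C = (\<lambda>x. b' \<otimes> x) ` ?C"
    by (auto simp: l_coset_def)
  moreover have "inj_on (\<lambda>x. b' \<otimes> x) ?C"
    using b'G conj_class_subset[OF c] by (auto simp: inj_on_def subset_iff)
  ultimately have cardC: "card (b' <# ?C) = card ?C"
    by (simp add: card_image)
  then have ge: "card ?C \<le> card ?E"
    using card_mono[OF finE sub] by simp
  have "card ?E \<le> card ?C"
    using E
  proof
    assume "coprime (card ?E) (card ?B)"
    then have "card ?E dvd card ?C"
      using dvd by (simp add: coprime_dvd_mult_right_iff)
    then show ?thesis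
      using less by (intro dvd_imp_le) auto
  next
    \<comment> \<open>This case is in fact incompatible with \<open>ge\<close>, but the bound
      follows from divisibility all the same.\<close>
    assume "coprime (card ?E) (card ?C)"
    then have "card ?E dvd card ?B"
      using dvd by (simp add: coprime_dvd_mult_left_iff)
    then have "card ?E \<le> card ?B"
      using Bpos by (rule dvd_imp_le)
    then show ?thesis
      using less by simp
  qed
  then show ?thesis
    using cardC ge by (intro card_subset_eq[OF finE sub]) simp
qed

section \<open>Left stabilisers of sets\<close>

lemma subgroup_left_stabilizer:
  assumes C: "C \<subseteq> carrier G"
  shows "subgroup {g \<in> carrier G. g <# C = C} G"
proof
  fix x y assume "x \<in> {g \<in> carrier G. g <# C = C}" "y \<in> {g \<in> carrier G. g <# C = C}"
  then show "x \<otimes> y \<in> {g \<in> carrier G. g <# C = C}"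
    using lcos_m_assoc[OF C, of x y] by simp
next
  fix x assume x: "x \<in> {g \<in> carrier G. g <# C = C}"
  then have "inv x <# C = inv x <# (x <# C)" by simp
  also have "\<dots> = C"
    using x lcos_m_assoc[OF C, of "inv x" x] lcos_mult_one[OF C] by simp
  finally show "inv x \<in> {g \<in> carrier G. g <# C = C}"
    using x by simp
qed (use C in \<open>auto simp: lcos_mult_one\<close>)

text \<open>Left multiplication by \<open>H\<close> sweeps out right cosets, so a stable
  \<open>C\<close> is a disjoint union of right cosets of \<open>H\<close>, all of the same size as
  \<open>H\<close>.\<close>

lemma card_subgroup_dvd_of_stable:
  assumes H: "subgroup H G" and C: "C \<subseteq> carrier G" "finite C"
    and stable: "\<And>h. h \<in> H \<Longrightarrow> h <# C \<subseteq> C"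
  shows "card H dvd card C"
proof -
  let ?P = "(\<lambda>c. H #> c) ` C"
  have HG: "H \<subseteq> carrier G"
    using H by (rule subgroup.subset)
  have P: "?P \<subseteq> rcosets H"
    using C HG by (auto intro: rcosetsI)
  have "\<Union>?P = C"
  proof
    show "\<Union>?P \<subseteq> C"
      using stable by (auto simp: r_coset_def l_coset_def)
    show "C \<subseteq> \<Union>?P"
      using C H rcos_self by blast
  qed
  moreover have "card H dvd card (\<Union>?P)"
  proof (rule dvd_partition)
    show "finite (\<Union>?P)"
      using C calculation by simp
    show "\<forall>R\<in>?P. card H dvd card R"
      using P HG card_rcosets_equal by (metis dvd_refl subsetD)
    show "\<forall>R\<in>?P. \<forall>S\<in>?P. R \<noteq> S \<longrightarrow> R \<inter> S = {}"
      using P rcos_disjoint[OF H] unfolding pairwise_def disjnt_def by blast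
  qed
  ultimately show ?thesis by simp
qed

text \<open>The intersection of the two stabilisers is a single subgroup under which both sets are
  stable, so its order divides two coprime numbers.\<close>

lemma left_stabilizers_Int_trivial:
  assumes C: "C \<subseteq> carrier G" "finite C" and D: "D \<subseteq> carrier G" "finite D"
    and cop: "coprime (card C) (card D)"
    and h: "h \<in> carrier G" "h <# C = C" "h <# D = D"
  shows "h = \<one>"
proof -
  let ?H = "{g \<in> carrier G. g <# C = C} \<inter> {g \<in> carrier G. g <# D = D}"
  have H: "subgroup ?H G"
    using C D by (intro subgroups_Inter_pair subgroup_left_stabilizer)
  have "card ?H dvd card C" "card ?H dvd card D"
    using C D by (intro card_subgroup_dvd_of_stable[OF H]; auto)+
  then have "card ?H = 1"
    by (rule coprime_common_divisor_nat[OF cop])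
  then obtain z where "?H = {z}"
    by (rule card_1_singletonE)
  moreover have "h \<in> ?H"
    using h by simp
  ultimately show ?thesis
    using subgroup.one_closed[OF H] by simp
qed

text \<open>Converts the equality of all translates \<open>b <# C\<close> for \<open>b\<close> in
  one class into elements of the stabiliser of \<open>C\<close>.\<close>

lemma translate_quotient:
  assumes C: "C \<subseteq> carrier G" and b: "b \<in> carrier G" "b' \<in> carrier G" and eq: "b <# C = b' <# C"
  shows "(inv b \<otimes> b') <# C = C"
proof -
  have "(inv b \<otimes> b') <# C = inv b <# (b <# C)"
    using lcos_m_assoc[OF C, of "inv b" b'] b eq by simp
  also have "\<dots> = C"
    using lcos_m_assoc[OF C, of "inv b" b] lcos_mult_one[OF C] b by simp
  finally show ?thesis .
qed

end

section \<open>Components and reachability\<close>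

text \<open>Three components would supply three mutually unreachable representatives. One direction
  per pair is enough, since reachability is symmetric in a \<open>pair_graph\<close>.\<close>

lemma pair_graph_n_components_le_2:
  assumes "pair_graph \<Gamma>"
    and three: "\<And>u v w. \<lbrakk>u \<in> pverts \<Gamma>; v \<in> pverts \<Gamma>; w \<in> pverts \<Gamma>; \<not> u \<rightarrow>\<^sup>*\<^bsub>with_proj \<Gamma>\<^esub> v;
      \<not> v \<rightarrow>\<^sup>*\<^bsub>with_proj \<Gamma>\<^esub> w; \<not> u \<rightarrow>\<^sup>*\<^bsub>with_proj \<Gamma>\<^esub> w\<rbrakk> \<Longrightarrow> False"
  shows "n_components \<Gamma> \<le> 2"
proof (rule ccontr)
  interpret pair_graph \<Gamma> by fact
  assume "\<not> n_components \<Gamma> \<le> 2"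
  \<comment> \<open>Components are counted through their vertex sets, which \<open>scc_of\<close>
    provides.\<close>
  then have "3 \<le> card (scc_of ` pverts \<Gamma>)"
    by (simp add: n_components_def flip: card_sccs_verts add: sccs_verts_conv_scc_of)
  then obtain T where T: "T \<subseteq> scc_of ` pverts \<Gamma>" "card T = 3"
    by (meson obtain_subset_with_card_n)
  obtain X Y Z where "T = {X, Y, Z}" "X \<noteq> Y" "Y \<noteq> Z" "X \<noteq> Z"
    using T(2) unfolding card_3_iff by blast
  then obtain u v w where uvw: "u \<in> pverts \<Gamma>" "v \<in> pverts \<Gamma>" "w \<in> pverts \<Gamma>"
      "scc_of u \<noteq> scc_of v" "scc_of v \<noteq> scc_of w" "scc_of u \<noteq> scc_of w"
    using T(1) by auto
  have "scc_of x = scc_of y" if "x \<rightarrow>\<^sup>*\<^bsub>with_proj \<Gamma>\<^esub> y" for x y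
  proof -
    have "y \<rightarrow>\<^sup>*\<^bsub>with_proj \<Gamma>\<^esub> x"
      using that by (rule symmetric_reachable[OF sym_arcs])
    then show ?thesis
      using that unfolding scc_of_def by (blast intro: reachable_trans)
  qed
  then show False
    using uvw three by metis
qed

text \<open>A common prime gives an arc unless the classes coincide; the graph has no loops, so that
  case rests on reflexivity. It serves in contrapositive form: separated classes have coprime
  sizes.\<close>

lemma class_graph_reachable:
  assumes "finite N" and C: "C \<in> pverts (class_graph G N)" and D: "D \<in> pverts (class_graph G N)"
    and ncop: "\<not> coprime (card C) (card D)"
  shows "C \<rightarrow>\<^sup>*\<^bsub>with_proj (class_graph G N)\<^esub> D"
proof -
  interpret pair_graph "class_graph G N"
    using assms(1) by (rule pair_graph_class_graph)
  show ?thesis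
  proof (cases "C = D")
    case True
    then show ?thesis using C by simp
  next
    case False
    then have "(C, D) \<in> parcs (class_graph G N)"
      using C D ex_prime_dvd_both[OF ncop] by (auto simp: class_graph_def Let_def)
    then show ?thesis
      by (intro reachable_adjI) (simp add: arcs_ends_def image_iff)
  qed
qed

section \<open>Three mutually unreachable classes\<close>

theorem theoremA:
  fixes G :: "('a, 'b) monoid_scheme" and N :: "'a set"
  assumes "group G" and "finite (carrier G)" and "N \<lhd> G"
  shows "n_components (class_graph G N) \<le> 2"
proof (rule pair_graph_n_components_le_2)
  interpret group G by fact
  interpret N: normal N G by fact
  let ?\<Gamma> = "with_proj (class_graph G N)" and ?V = "pverts (class_graph G N)"
  have finN: "finite N"
    using assms(2) N.subset finite_subset by blast
  show pg: "pair_graph (class_graph G N)"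
    by (rule pair_graph_class_graph[OF finN])
  interpret pair_graph "class_graph G N"
    by (rule pg)
  have sym: "\<not> y \<rightarrow>\<^sup>*\<^bsub>?\<Gamma>\<^esub> x" if "\<not> x \<rightarrow>\<^sup>*\<^bsub>?\<Gamma>\<^esub> y" for x y
    using that symmetric_reachable[OF sym_arcs] by blast
  have V: "C \<in> ?V \<longleftrightarrow> (\<exists>x\<in>N. C = conj_class G x \<and> card C \<noteq> 1)" for C
    by (auto simp: class_graph_def Let_def conj_classes_def central_class_iff_card)
  have V_subset: "C \<subseteq> carrier G" if "C \<in> ?V" for C
    using that conj_class_subset[OF N.mem_carrier] by (force simp: V)
  have V_finite: "finite C" if "C \<in> ?V" for C
    using V_subset[OF that] assms(2) finite_subset by blast
  have coprime: "coprime (card C) (card D)" if "C \<in> ?V" "D \<in> ?V" "\<not> C \<rightarrow>\<^sup>*\<^bsub>?\<Gamma>\<^esub> D" for C D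
    using that class_graph_reachable[OF finN] by blast
  have translate: "(inv\<^bsub>G\<^esub> x \<otimes>\<^bsub>G\<^esub> y) <#\<^bsub>G\<^esub> C = C"
    if B: "B \<in> ?V" and C: "C \<in> ?V" and sep: "\<not> B \<rightarrow>\<^sup>*\<^bsub>?\<Gamma>\<^esub> C" and less: "card B < card C"
      and xy: "x \<in> B" "y \<in> B" for B C x y
  proof -
    obtain b c where b: "b \<in> N" "B = conj_class G b" and c: "c \<in> N" "C = conj_class G c"
      using B C by (auto simp: V)
    define E where "E = conj_class G (b \<otimes>\<^bsub>G\<^esub> c)"
    \<comment> \<open>Normality keeps the product in \<open>N\<close>, so \<open>E\<close> is a
      vertex or has size 1. A vertex sharing primes with both \<open>B\<close> and \<open>C\<close>
      would connect them.\<close>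
    have E: "coprime (card E) (card B) \<or> coprime (card E) (card C)"
    proof (cases "card E = 1")
      case False
      then have "E \<in> ?V"
        using b c by (auto simp: V E_def)
      then show ?thesis
        using coprime[OF B, of E] coprime[OF _ C, of E] sep reachable_trans
        by (metis coprime_commute)
    qed simp
    have "z <#\<^bsub>G\<^esub> C = E" if "z \<in> B" for z
      using coprime_class_translate[OF assms(2), of b c z] b c coprime[OF B C sep] less E that
      by (simp add: E_def)
    then show ?thesis
      using xy V_subset[OF B] V_subset[OF C] by (intro translate_quotient) auto
  qed
  \<comment> \<open>Only \<open>B\<close> needs to be the smallest: it is the class that translates
    both \<open>C\<close> and \<open>D\<close>.\<close>
  have ordered: False
    if B: "B \<in> ?V" and C: "C \<in> ?V" and D: "D \<in> ?V"
      and sep: "\<not> B \<rightarrow>\<^sup>*\<^bsub>?\<Gamma>\<^esub> C" "\<not> B \<rightarrow>\<^sup>*\<^bsub>?\<Gamma>\<^esub> D" "\<not> C \<rightarrow>\<^sup>*\<^bsub>?\<Gamma>\<^esub> D"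
      and less: "card B < card C" "card B < card D" for B C D
  proof -
    \<comment> \<open>The quotient of \<open>x\<close> and \<open>y\<close> stabilises both
      \<open>C\<close> and \<open>D\<close>, hence is trivial; this makes \<open>B\<close> a
      singleton, which no vertex is.\<close>
    have "x = y" if xy: "x \<in> B" "y \<in> B" for x y
    proof -
      have xyG: "x \<in> carrier G" "y \<in> carrier G"
        using xy V_subset[OF B] by auto
      have "inv\<^bsub>G\<^esub> x \<otimes>\<^bsub>G\<^esub> y = \<one>\<^bsub>G\<^esub>"
        using xyG translate[OF B C sep(1) less(1) xy] translate[OF B D sep(2) less(2) xy]
        by (intro left_stabilizers_Int_trivial[OF V_subset[OF C] V_finite[OF C]
              V_subset[OF D] V_finite[OF D] coprime[OF C D sep(3)]]) auto
      then show ?thesis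
        using xyG by (metis inv_closed inv_equality inv_inv)
    qed
    moreover obtain b where "b \<in> B"
      using B conj_class_self[OF N.mem_carrier] by (force simp: V)
    ultimately have "B = {b}" by blast
    then show False
      using B by (auto simp: V)
  qed
  fix B C D
  assume B: "B \<in> ?V" and C: "C \<in> ?V" and D: "D \<in> ?V"
    and sep: "\<not> B \<rightarrow>\<^sup>*\<^bsub>?\<Gamma>\<^esub> C" "\<not> C \<rightarrow>\<^sup>*\<^bsub>?\<Gamma>\<^esub> D" "\<not> B \<rightarrow>\<^sup>*\<^bsub>?\<Gamma>\<^esub> D"
  \<comment> \<open>Equal coprime sizes would both be 1.\<close>
  have ne: "card X \<noteq> card Y" if "X \<in> ?V" "Y \<in> ?V" "\<not> X \<rightarrow>\<^sup>*\<^bsub>?\<Gamma>\<^esub> Y" for X Y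
    using coprime[OF that] that(1) by (auto simp: V)
  \<comment> \<open>The cases record which class is the smallest; it then takes the role of
    \<open>B\<close> in \<open>ordered\<close>.\<close>
  consider "card B < card C" "card B < card D" | "card C < card B" "card C < card D"
    | "card D < card B" "card D < card C"
    using ne[OF B C sep(1)] ne[OF C D sep(2)] ne[OF B D sep(3)] by linarith
  then show False
  proof cases
    case 1
    then show ?thesis using ordered[OF B C D] sep by blast
  next
    case 2
    then show ?thesis using ordered[OF C B D] sep sym by blast
  next
    case 3
    then show ?thesis using ordered[OF D B C] sep sym by blast
  qed
qed

end
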